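(* Let $n,m$ be natural numbers and define the $2(n+m)\times 2(n+m)$ matrices (block sizes $n,m,n,m$) $$\hat W_{\alpha}=\begin{pmatrix}0&0&-I_n&0\\0&0&0&I_m\\-I_n&0&0&0\\0&I_m&0&0\end{pmatrix},\qquad \hat W_{\beta}=\begin{pmatrix}0&0&-I_n&0\\0&-I_m&0&0\\-I_n&0&0&0\\0&0&0&I_m\end{pmatrix},$$ $$\hat W_{\gamma}=\begin{pmatrix}-I_n&0&0&0\\0&0&0&I_m\\0&0&I_n&0\\0&I_m&0&0\end{pmatrix},\qquad \hat W_{\delta}=\begin{pmatrix}-I_n&0&0&0\\0&-I_m&0&0\\0&0&I_n&0\\0&0&0&I_m\end{pmatrix}.$$ Fix $l\in\{\alpha,\beta,\gamma,\delta\}$. Let $k$ be a natural number and let $F_1(z),\dots,F_k(z)$ be $m\times m$-valued rational functions admitting $(n+m)\times(n+m)$ realizations $$R_{F_j}=\begin{pmatrix}A_j&B_j\\ C_j&D_j\end{pmatrix},\qquad j=1,\dots,k,$$ all satisfying $$\begin{pmatrix}R_{F_j}\\ I_{n+m}\end{pmatrix}^*\hat W_l\begin{pmatrix}R_{F_j}\\ I_{n+m}\end{pmatrix}\in\overline{\mathbf{P}}_{n+m},\qquad j=1,\dots,k.$$ Let $\Upsilon_j=\begin{pmatrix}\Upsilon_{j,n}&0\\0&\Upsilon_{j,m}\end{pmatrix}$ with $\Upsilon_{j,n}\in\mathbb{C}^{n\times n}$, $\Upsilon_{j,m}\in\mathbb{C}^{m\times m}$, $j=1,\dots,k$, be such that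 $\sum_{j=1}^k\Upsilon_j^*\Upsilon_j=I_{n+m}$, and put $$R_F:=\sum_{j=1}^k\Upsilon_j^*R_{F_j}\Upsilon_j .$$ Then $R_F$ satisfies the same relation: $$\begin{pmatrix}R_F\\ I_{n+m}\end{pmatrix}^*\hat W_l\begin{pmatrix}R_F\\ I_{n+m}\end{pmatrix}\in\overline{\mathbf{P}}_{n+m}.$$ In other words, for each $l\in\{\alpha,\beta,\gamma,\delta\}$ (corresponding to the families $\mathcal{P}$, $\mathcal{B}$, $\mathcal{DP}$, $\mathcal{DB}$, respectively), the set of all arrays $R\in\mathbb{C}^{(n+m)\times(n+m)}$ satisfying $\begin{pmatrix}R\\ I_{n+m}\end{pmatrix}^*\hat W_l\begin{pmatrix}R\\ I_{n+m}\end{pmatrix}\in\overline{\mathbf{P}}_{n+m}$ is $n,m$-matrix-convex.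
   Context: $\overline{\mathbf{P}}_{q}$ denotes the set of $q\times q$ Hermitian positive semi-definite matrices; $X^*$ is the conjugate transpose. A realization of an $m\times m$-valued rational function $F$ is an array $R_F=\begin{pmatrix}A&B\\ C&D\end{pmatrix}$ with $A\in\mathbb{C}^{n\times n}$, $B\in\mathbb{C}^{n\times m}$, $C\in\mathbb{C}^{m\times n}$, $D\in\mathbb{C}^{m\times m}$ and $F(z)=C(zI_n-A)^{-1}B+D$ (not necessarily minimal). A set $\mathbf{R}$ of $(n+m)\times(n+m)$ matrices is called $n,m$-matrix-convex if for every natural $k$, all $R_1,\dots,R_k\in\mathbf{R}$ and all block-diagonal $\Upsilon_j=\begin{pmatrix}\Upsilon_{j,n}&0\\0&\Upsilon_{j,m}\end{pmatrix}$, with $\Upsilon_{j,n}\in\mathbb{C}^{n\times n}$ and $\Upsilon_{j,m}\in\mathbb{C}^{m\times m}$, satisfying $\sum_{j=1}^k\Upsilon_j^*\Upsilon_j=I_{n+m}$, the matrix $\sum_{j=1}^k\Upsilon_j^*R_j\Upsilon_j$ belongs to $\mathbf{R}$. The labels $\mathcal{P}$, $\mathcal{B}$, $\mathcal{DP}$, $\mathcal{DB}$ refer to the families of Positive-Real, Bounded-Real, Discrete-Time-Positive-Real and Discrete-Time-Bounded-Real rational functions; they serve only to name the four cases and are not otherwise used in the claim. *)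

theory Defs
  imports
    "Jordan_Normal_Form.Schur_Decomposition"
    "HOL-Computational_Algebra.Polynomial_Factorial"
begin

(* A rational m x m matrix function is a matrix over the field of fractions of complex
   polynomials; the indeterminate z is to_fract [:0, 1:], the constant c is to_fract [:c:]. *)
type_synonym rat_fun_mat = "complex poly fract mat"

definition const_mat :: "complex mat \<Rightarrow> rat_fun_mat" where
  "const_mat = map_mat (\<lambda>c. to_fract [:c:])"

(* X is the inverse of z I - A; since det (z I - A) is a nonzero polynomial, this inverse
   exists (and is unique) over the field of rational functions for every A. *)
definition is_realization :: "nat \<Rightarrow> nat \<Rightarrow> rat_fun_mat \<Rightarrow> complex mat \<Rightarrow> bool" where
  "is_realization n m F R \<longleftrightarrow>
    (\<exists>A\<in>carrier_mat n n. \<exists>B\<in>carrier_mat n m. \<exists>C\<in>carrier_mat m n. \<exists>D\<in>carrier_mat m m.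
       R = four_block_mat A B C D \<and>
       (\<exists>X\<in>carrier_mat n n.
          inverts_mat (to_fract [:0, 1:] \<cdot>\<^sub>m 1\<^sub>m n - const_mat A) X \<and>
          inverts_mat X (to_fract [:0, 1:] \<cdot>\<^sub>m 1\<^sub>m n - const_mat A) \<and>
          F = const_mat C * X * const_mat B + const_mat D))"

(* Note that v \<bullet>c w is linear in v and conjugate-linear in w. *)
definition psd_mats :: "nat \<Rightarrow> complex mat set" where
  "psd_mats q = {P \<in> carrier_mat q q. mat_adjoint P = P \<and>
     (\<forall>v\<in>carrier_vec q. 0 \<le> Re ((P *\<^sub>v v) \<bullet>c v))}"

definition block_diag :: "complex mat \<Rightarrow> complex mat \<Rightarrow> complex mat" where
  "block_diag P Q =
    four_block_mat P (0\<^sub>m (dim_row P) (dim_col Q)) (0\<^sub>m (dim_row Q) (dim_col P)) Q"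

(* Sum of d x d matrices, taken entrywise: the type of matrices of all sizes
   is not a commutative monoid under addition. *)
definition mat_sum :: "nat \<Rightarrow> 'i set \<Rightarrow> ('i \<Rightarrow> complex mat) \<Rightarrow> complex mat" where
  "mat_sum d J f = mat d d (\<lambda>ab. \<Sum>j\<in>J. f j $$ ab)"

lemma mat_sum_empty: "mat_sum d {} f = 0\<^sub>m d d"
  by (auto simp: mat_sum_def)

lemma mat_sum_insert:
  assumes "finite J" "j \<notin> J" "f j \<in> carrier_mat d d"
  shows "mat_sum d (insert j J) f = f j + mat_sum d J f"
  using assms by (intro eq_matI) (auto simp: mat_sum_def)

datatype label = Label_alpha | Label_beta | Label_gamma | Label_delta

(* Each matrix is given by its four blocks of size n + m. *)
fun W_hat :: "nat \<Rightarrow> nat \<Rightarrow> label \<Rightarrow> complex mat" where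
  "W_hat n m Label_alpha = four_block_mat
     (0\<^sub>m (n + m) (n + m))             (block_diag (- 1\<^sub>m n) (1\<^sub>m m))
     (block_diag (- 1\<^sub>m n) (1\<^sub>m m))   (0\<^sub>m (n + m) (n + m))"
| "W_hat n m Label_beta = four_block_mat
     (block_diag (0\<^sub>m n n) (- 1\<^sub>m m))   (block_diag (- 1\<^sub>m n) (0\<^sub>m m m))
     (block_diag (- 1\<^sub>m n) (0\<^sub>m m m))   (block_diag (0\<^sub>m n n) (1\<^sub>m m))"
| "W_hat n m Label_gamma = four_block_mat
     (block_diag (- 1\<^sub>m n) (0\<^sub>m m m))   (block_diag (0\<^sub>m n n) (1\<^sub>m m))
     (block_diag (0\<^sub>m n n) (1\<^sub>m m))     (block_diag (1\<^sub>m n) (0\<^sub>m m m))"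
| "W_hat n m Label_delta = four_block_mat
     (block_diag (- 1\<^sub>m n) (- 1\<^sub>m m))   (0\<^sub>m (n + m) (n + m))
     (0\<^sub>m (n + m) (n + m))             (block_diag (1\<^sub>m n) (1\<^sub>m m))"

definition satisfies_W :: "nat \<Rightarrow> nat \<Rightarrow> label \<Rightarrow> complex mat \<Rightarrow> bool" where
  "satisfies_W n m l R \<longleftrightarrow>
    mat_adjoint (R @\<^sub>r 1\<^sub>m (n + m)) * W_hat n m l * (R @\<^sub>r 1\<^sub>m (n + m)) \<in> psd_mats (n + m)"

definition matrix_convex :: "nat \<Rightarrow> nat \<Rightarrow> complex mat set \<Rightarrow> bool" where
  "matrix_convex n m S \<longleftrightarrow> S \<subseteq> carrier_mat (n + m) (n + m) \<and>
    (\<forall>(k::nat) R Yn Ym.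
       (\<forall>j\<in>{1..k}. R j \<in> S \<and> Yn j \<in> carrier_mat n n \<and> Ym j \<in> carrier_mat m m) \<longrightarrow>
       mat_sum (n + m) {1..k}
         (\<lambda>j. mat_adjoint (block_diag (Yn j) (Ym j)) * block_diag (Yn j) (Ym j)) = 1\<^sub>m (n + m) \<longrightarrow>
       mat_sum (n + m) {1..k}
         (\<lambda>j. mat_adjoint (block_diag (Yn j) (Ym j)) * R j * block_diag (Yn j) (Ym j)) \<in> S)"

end

theory Submission
  imports Defs
begin

text \<open>
  Each weight matrix has the form \<open>(-E, Q; Q, S)\<close> in blocks of size \<open>n + m\<close>, with \<open>E\<close>, \<open>Q\<close>,
  \<open>S\<close> scalar on the two diagonal blocks and \<open>E\<close> positive semidefinite. The relation for \<open>R\<close>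
  therefore says that \<open>M(R) = R\<^sup>* Q + Q R + S - R\<^sup>* E R\<close> is positive semidefinite: an expression
  that is matrix-concave in \<open>R\<close>, since its only nonlinear term is \<open>- R\<^sup>* E R\<close>.

  Concavity becomes an exact identity. For \<open>T = \<Sum> Y\<^sub>j\<^sup>* R\<^sub>j Y\<^sub>j\<close> with \<open>\<Sum> Y\<^sub>j\<^sup>* Y\<^sub>j = 1\<close>, put
  \<open>Z\<^sub>j = R\<^sub>j Y\<^sub>j - Y\<^sub>j T\<close>, the defect of \<open>Y\<^sub>j\<close> as an intertwiner of \<open>T\<close> and \<open>R\<^sub>j\<close>. Since the
  block-diagonal \<open>Y\<^sub>j\<close> and \<open>Y\<^sub>j\<^sup>*\<close> commute with block scalars,
  \<open>M(T) = \<Sum> Y\<^sub>j\<^sup>* M(R\<^sub>j) Y\<^sub>j + \<Sum> Z\<^sub>j\<^sup>* E Z\<^sub>j\<close>,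
  and both sums are positive semidefinite. The identity rests on \<open>completed_square\<close>, which gives
  each summand on the right in terms linear in \<open>Y\<^sub>j\<^sup>* R\<^sub>j Y\<^sub>j\<close>, its adjoint and \<open>Y\<^sub>j\<^sup>* Y\<^sub>j\<close>, so that
  summation replaces these by \<open>T\<close>, \<open>T\<^sup>*\<close> and \<open>1\<close>; \<open>quadratic_inequality_isometric_average\<close> carries
  this out. The four cases differ only in the scalars of \<open>E\<close>, \<open>Q\<close> and \<open>S\<close>
  (\<open>W_hat_block_scalar\<close>).
\<close>

section \<open>Conjugate transposes\<close>

lemma mat_adjoint_dim [simp]:
  "dim_row (mat_adjoint A) = dim_col A" "dim_col (mat_adjoint A) = dim_row A"
  by (auto simp: mat_adjoint_def)

lemma mat_adjoint_carrier [simp]: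
  "A \<in> carrier_mat r c \<Longrightarrow> mat_adjoint A \<in> carrier_mat c r"
  by (rule carrier_matI) auto

lemma mat_adjoint_index [simp]:
  "i < dim_col A \<Longrightarrow> j < dim_row A \<Longrightarrow> mat_adjoint A $$ (i, j) = conjugate (A $$ (j, i))"
  by (auto simp: mat_adjoint_def mat_of_rows_def)

lemma mat_adjoint_mat_adjoint [simp]: "mat_adjoint (mat_adjoint A) = A"
  by (intro eq_matI) auto

lemma mat_adjoint_add:
  fixes A B :: "complex mat"
  assumes "A \<in> carrier_mat r c" "B \<in> carrier_mat r c"
  shows "mat_adjoint (A + B) = mat_adjoint A + mat_adjoint B"
  using assms by (intro eq_matI) auto

lemma mat_adjoint_minus:
  fixes A B :: "complex mat"
  assumes "A \<in> carrier_mat r c" "B \<in> carrier_mat r c"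
  shows "mat_adjoint (A - B) = mat_adjoint A - mat_adjoint B"
  using assms by (intro eq_matI) auto

lemma mat_adjoint_mult:
  fixes A B :: "complex mat"
  assumes "A \<in> carrier_mat r q" "B \<in> carrier_mat q c"
  shows "mat_adjoint (A * B) = mat_adjoint B * mat_adjoint A"
  using assms
  by (intro eq_matI) (auto simp: scalar_prod_def mult.commute intro!: sum.cong)

lemma mat_adjoint_cscalar_prod:
  fixes A :: "complex mat"
  assumes A: "A \<in> carrier_mat r c" and v: "v \<in> carrier_vec c" and w: "w \<in> carrier_vec r"
  shows "(mat_adjoint A *\<^sub>v w) \<bullet>c v = w \<bullet>c (A *\<^sub>v v)"
proof -
  have dims: "dim_row A = r" "dim_col A = c" "dim_vec v = c" "dim_vec w = r"
    using assms by auto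
  have "(mat_adjoint A *\<^sub>v w) \<bullet>c v =
      (\<Sum>i<c. \<Sum>j<r. conjugate (A $$ (j, i)) * w $ j * conjugate (v $ i))"
    by (auto simp: scalar_prod_def sum_distrib_right dims atLeast0LessThan intro!: sum.cong)
  also have "\<dots> = (\<Sum>j<r. \<Sum>i<c. conjugate (A $$ (j, i)) * w $ j * conjugate (v $ i))"
    by (rule sum.swap)
  also have "\<dots> = w \<bullet>c (A *\<^sub>v v)"
    by (auto simp: scalar_prod_def sum_distrib_left dims atLeast0LessThan mult_ac intro!: sum.cong)
  finally show ?thesis .
qed

section \<open>The cone of positive semidefinite matrices\<close>

lemma zero_mem_psd_mats: "0\<^sub>m N N \<in> psd_mats N"
proof -
  have "(0\<^sub>m N N *\<^sub>v v) \<bullet>c v = 0" if "v \<in> carrier_vec N" for v :: "complex vec"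
    using that by (auto simp: scalar_prod_def)
  then show ?thesis by (auto simp: psd_mats_def intro!: eq_matI)
qed

lemma psd_mats_add:
  assumes "P \<in> psd_mats N" "Q \<in> psd_mats N"
  shows "P + Q \<in> psd_mats N"
proof -
  have P: "P \<in> carrier_mat N N" "mat_adjoint P = P"
    and Q: "Q \<in> carrier_mat N N" "mat_adjoint Q = Q"
    using assms by (auto simp: psd_mats_def)
  have "0 \<le> Re (((P + Q) *\<^sub>v v) \<bullet>c v)" if v: "v \<in> carrier_vec N" for v
  proof -
    have "((P + Q) *\<^sub>v v) \<bullet>c v = (P *\<^sub>v v) \<bullet>c v + (Q *\<^sub>v v) \<bullet>c v"
      using P Q v
      by (simp add: add_mult_distrib_mat_vec[of _ N N] add_scalar_prod_distrib[of _ N])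
    then show ?thesis using assms v by (auto simp: psd_mats_def)
  qed
  then show ?thesis using P Q by (auto simp: psd_mats_def mat_adjoint_add[of _ N N])
qed

lemma psd_mats_congruence:
  assumes P: "P \<in> psd_mats N" and Z: "Z \<in> carrier_mat N N"
  shows "mat_adjoint Z * P * Z \<in> psd_mats N"
proof -
  have Pc: "P \<in> carrier_mat N N" "mat_adjoint P = P" using P by (auto simp: psd_mats_def)
  have "0 \<le> Re (((mat_adjoint Z * P * Z) *\<^sub>v v) \<bullet>c v)" if v: "v \<in> carrier_vec N" for v
  proof -
    have "(mat_adjoint Z * P * Z) *\<^sub>v v = mat_adjoint Z *\<^sub>v (P *\<^sub>v (Z *\<^sub>v v))"
      using Pc Z v by (simp add: assoc_mult_mat_vec[of _ N N _ N] mult_carrier_mat[of _ N N _ N])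
    also have "\<dots> \<bullet>c v = (P *\<^sub>v (Z *\<^sub>v v)) \<bullet>c (Z *\<^sub>v v)"
      using Pc Z v by (intro mat_adjoint_cscalar_prod[of _ N N]) auto
    finally show ?thesis using P Z v by (auto simp: psd_mats_def)
  qed
  moreover have "mat_adjoint (mat_adjoint Z * P * Z) = mat_adjoint Z * P * Z"
    using Pc Z by (simp add: mat_adjoint_mult[of _ N N _ N] assoc_mult_mat[of _ N N _ N _ N] mult_carrier_mat[of _ N N _ N])
  ultimately show ?thesis using Pc Z by (auto simp: psd_mats_def)
qed

lemma psd_mats_mat_sum:
  assumes "finite J" "\<And>j. j \<in> J \<Longrightarrow> f j \<in> psd_mats N"
  shows "mat_sum N J f \<in> psd_mats N"
  using assms
proof (induction J rule: finite_induct)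
  case empty
  then show ?case by (simp add: mat_sum_empty zero_mem_psd_mats)
next
  case (insert j J)
  then have "f j \<in> carrier_mat N N" by (auto simp: psd_mats_def)
  with insert show ?case by (simp add: mat_sum_insert psd_mats_add)
qed

section \<open>Linearity of matrix sums\<close>

lemma mat_sum_carrier [simp]: "mat_sum N J f \<in> carrier_mat N N"
  by (simp add: mat_sum_def)

lemma mat_sum_cong:
  "(\<And>j. j \<in> J \<Longrightarrow> f j = g j) \<Longrightarrow> mat_sum N J f = mat_sum N J g"
  unfolding mat_sum_def by (intro cong_mat) auto

lemma mat_sum_add:
  assumes "\<And>j. j \<in> J \<Longrightarrow> f j \<in> carrier_mat N N" "\<And>j. j \<in> J \<Longrightarrow> g j \<in> carrier_mat N N"
  shows "mat_sum N J (\<lambda>j. f j + g j) = mat_sum N J f + mat_sum N J g"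
proof -
  have dims: "dim_row (g j) = N" "dim_col (g j) = N" if "j \<in> J" for j
    using assms(2)[OF that] by auto
  show ?thesis
    by (intro eq_matI) (simp_all add: mat_sum_def sum.distrib dims cong: sum.cong)
qed

lemma mat_sum_minus:
  assumes "\<And>j. j \<in> J \<Longrightarrow> f j \<in> carrier_mat N N" "\<And>j. j \<in> J \<Longrightarrow> g j \<in> carrier_mat N N"
  shows "mat_sum N J (\<lambda>j. f j - g j) = mat_sum N J f - mat_sum N J g"
proof -
  have dims: "dim_row (g j) = N" "dim_col (g j) = N" if "j \<in> J" for j
    using assms(2)[OF that] by auto
  show ?thesis
    by (intro eq_matI) (simp_all add: mat_sum_def sum_subtractf dims cong: sum.cong)
qed

lemma mat_sum_mult_left:
  assumes "A \<in> carrier_mat N N" "finite J" "\<And>j. j \<in> J \<Longrightarrow> f j \<in> carrier_mat N N"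
  shows "mat_sum N J (\<lambda>j. A * f j) = A * mat_sum N J f"
  using assms(2,3)
proof (induction J rule: finite_induct)
  case empty
  then show ?case using assms(1) by (simp add: mat_sum_empty)
next
  case (insert j J)
  then show ?case using assms(1) by (simp add: mat_sum_insert mult_add_distrib_mat[of _ N N _ N])
qed

lemma mat_sum_mult_right:
  assumes "A \<in> carrier_mat N N" "finite J" "\<And>j. j \<in> J \<Longrightarrow> f j \<in> carrier_mat N N"
  shows "mat_sum N J (\<lambda>j. f j * A) = mat_sum N J f * A"
  using assms(2,3)
proof (induction J rule: finite_induct)
  case empty
  then show ?case using assms(1) by (simp add: mat_sum_empty)
next
  case (insert j J)
  then show ?case using assms(1) by (simp add: mat_sum_insert add_mult_distrib_mat[of _ N N _ _ N] mult_carrier_mat[of _ N N _ N])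
qed

lemma mat_adjoint_mat_sum:
  assumes "\<And>j. j \<in> J \<Longrightarrow> f j \<in> carrier_mat N N"
  shows "mat_adjoint (mat_sum N J f) = mat_sum N J (\<lambda>j. mat_adjoint (f j))"
proof -
  have dims: "dim_row (f j) = N" "dim_col (f j) = N" if "j \<in> J" for j
    using assms[OF that] by auto
  show ?thesis
    by (intro eq_matI) (simp_all add: mat_sum_def dims cong: sum.cong)
qed

section \<open>Quadratic matrix inequalities under isometric averages\<close>

text \<open>
  The minus sign on the first block makes a positive semidefinite \<open>E\<close> correspond to a concave
  right-hand side.
\<close>

lemma stacked_congruence:
  fixes E Q S R :: "complex mat"
  assumes [simp]: "E \<in> carrier_mat N N" "Q \<in> carrier_mat N N" "S \<in> carrier_mat N N" "R \<in> carrier_mat N N"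
  shows "mat_adjoint (R @\<^sub>r 1\<^sub>m N) * four_block_mat (- E) Q Q S * (R @\<^sub>r 1\<^sub>m N) =
    mat_adjoint R * Q + Q * R + S - mat_adjoint R * E * R"
proof -
  note dims = assms[THEN carrier_matD(1)] assms[THEN carrier_matD(2)]
  have st: "R @\<^sub>r 1\<^sub>m N = four_block_mat R (0\<^sub>m N 0) (1\<^sub>m N) (0\<^sub>m N 0)"
    by (simp add: append_rows_def dims)
  have adj: "mat_adjoint (R @\<^sub>r 1\<^sub>m N) = four_block_mat (mat_adjoint R) (1\<^sub>m N) (0\<^sub>m 0 N) (0\<^sub>m 0 N)"
    unfolding st by (intro eq_matI) (auto simp: dims)
  have "mat_adjoint (R @\<^sub>r 1\<^sub>m N) * four_block_mat (- E) Q Q S =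
      four_block_mat (Q - mat_adjoint R * E) (mat_adjoint R * Q + S) (0\<^sub>m 0 N) (0\<^sub>m 0 N)"
    unfolding adj
    by (subst mult_four_block_mat[of _ N N _ N _ 0 _ _ N _ N])
       (simp_all, rule cong_four_block_mat, auto simp: dims intro!: eq_matI)
  also have "\<dots> * (R @\<^sub>r 1\<^sub>m N) = four_block_mat
      ((Q - mat_adjoint R * E) * R + (mat_adjoint R * Q + S)) (0\<^sub>m N 0) (0\<^sub>m 0 N) (0\<^sub>m 0 0)"
    unfolding st
    by (subst mult_four_block_mat[of _ N N _ N _ 0 _ _ N _ 0])
       (auto simp: dims intro!: cong_four_block_mat)
  also have "\<dots> = (Q - mat_adjoint R * E) * R + (mat_adjoint R * Q + S)"
    by (intro eq_matI) (auto simp: dims)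
  also have "\<dots> = mat_adjoint R * Q + Q * R + S - mat_adjoint R * E * R"
    by (subst minus_mult_distrib_mat[of _ N N _ _ N]) (auto simp: dims intro!: eq_matI)
  finally show ?thesis .
qed

text \<open>
  Moving \<open>E\<close> and \<open>Q\<close> past \<open>Y\<close> and \<open>Y\<^sup>*\<close> turns the quadratic term of the first summand into
  \<open>- (R Y)\<^sup>* E (R Y)\<close>, which is exactly what the expansion of \<open>Z\<^sup>* E Z\<close> cancels. What remains is
  additive in the pair \<open>(G, H)\<close> while \<open>T\<close> stays fixed, so it can be summed over a family of pairs
  \<open>(R, Y)\<close>; this is why \<open>T\<close> is arbitrary at this stage.
\<close>

lemma completed_square:
  fixes E Q S R Y T :: "complex mat"
  assumes [simp]: "E \<in> carrier_mat N N" "Q \<in> carrier_mat N N" "S \<in> carrier_mat N N"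
      "R \<in> carrier_mat N N" "Y \<in> carrier_mat N N" "T \<in> carrier_mat N N"
    and EY: "E * Y = Y * E" "E * mat_adjoint Y = mat_adjoint Y * E"
    and QY: "Q * Y = Y * Q" "Q * mat_adjoint Y = mat_adjoint Y * Q"
    and SY: "S * Y = Y * S"
  defines "G \<equiv> mat_adjoint Y * R * Y" and "H \<equiv> mat_adjoint Y * Y"
    and "Z \<equiv> R * Y - Y * T"
  shows "mat_adjoint Y * (mat_adjoint R * Q + Q * R + S - mat_adjoint R * E * R) * Y
      + mat_adjoint Z * E * Z =
    mat_adjoint G * Q + Q * G + H * S
      - mat_adjoint G * (E * T) - (mat_adjoint T * E) * G + mat_adjoint T * (H * (E * T))"
proof -
  \<comment> \<open>The normal form of a product is associated to the right, with \<open>Y\<close> and \<open>Y\<^sup>*\<close> to the left of the weights.\<close>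
  have push: "E * (Y * X) = Y * (E * X)" "E * (mat_adjoint Y * X) = mat_adjoint Y * (E * X)"
    "Q * (Y * X) = Y * (Q * X)" "Q * (mat_adjoint Y * X) = mat_adjoint Y * (Q * X)"
    "S * (Y * X) = Y * (S * X)"
    if [simp]: "X \<in> carrier_mat N N" for X
    by (simp_all del: assoc_mult_mat flip: assoc_mult_mat[of _ N N _ N _ N] add: EY QY SY mult_carrier_mat[of _ N N _ N])
  note dims = assms(1-6)[THEN carrier_matD(1)] assms(1-6)[THEN carrier_matD(2)]
  note square = mult_carrier_mat[of _ N N _ N] minus_carrier_mat[of _ N N] assoc_mult_mat[of _ N N _ N _ N]
    mult_add_distrib_mat[of _ N N _ N] add_mult_distrib_mat[of _ N N _ _ N]
    mult_minus_distrib_mat[of _ N N _ N] minus_mult_distrib_mat[of _ N N _ _ N]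
    mat_adjoint_mult[of _ N N _ N] mat_adjoint_minus[of _ N N]
  show ?thesis
    unfolding G_def H_def Z_def
    by (simp add: square push EY QY SY) (rule eq_matI, simp_all add: dims)
qed

text \<open>
  The right-hand side of \<open>completed_square\<close> sums to the same expression with \<open>G = T\<close> and \<open>H = 1\<close>.
  There the two mixed terms contribute \<open>- 2 T\<^sup>* E T\<close> and the last one \<open>T\<^sup>* E T\<close>, which leaves the
  quadratic inequality for \<open>T\<close>.
\<close>

theorem quadratic_inequality_isometric_average:
  fixes E Q S :: "complex mat" and R Y :: "'i \<Rightarrow> complex mat"
  assumes J: "finite J"
    and E: "E \<in> psd_mats N"
    and Q: "Q \<in> carrier_mat N N" and S: "S \<in> carrier_mat N N"
    and R: "\<And>j. j \<in> J \<Longrightarrow> R j \<in> carrier_mat N N"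
    and Y: "\<And>j. j \<in> J \<Longrightarrow> Y j \<in> carrier_mat N N"
    and EY: "\<And>j. j \<in> J \<Longrightarrow> E * Y j = Y j * E"
      "\<And>j. j \<in> J \<Longrightarrow> E * mat_adjoint (Y j) = mat_adjoint (Y j) * E"
    and QY: "\<And>j. j \<in> J \<Longrightarrow> Q * Y j = Y j * Q"
      "\<And>j. j \<in> J \<Longrightarrow> Q * mat_adjoint (Y j) = mat_adjoint (Y j) * Q"
    and SY: "\<And>j. j \<in> J \<Longrightarrow> S * Y j = Y j * S"
    and iso: "mat_sum N J (\<lambda>j. mat_adjoint (Y j) * Y j) = 1\<^sub>m N"
    and ineq: "\<And>j. j \<in> J \<Longrightarrow> mat_adjoint (R j) * Q + Q * R j + S
        - mat_adjoint (R j) * E * R j \<in> psd_mats N"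
  defines "T \<equiv> mat_sum N J (\<lambda>j. mat_adjoint (Y j) * R j * Y j)"
  shows "mat_adjoint T * Q + Q * T + S - mat_adjoint T * E * T \<in> psd_mats N"
proof -
  define G H where "G = (\<lambda>j. mat_adjoint (Y j) * R j * Y j)"
    and "H = (\<lambda>j. mat_adjoint (Y j) * Y j)"
  define M where "M = (\<lambda>j. mat_adjoint (R j) * Q + Q * R j + S - mat_adjoint (R j) * E * R j)"
  define Z where "Z = (\<lambda>j. R j * Y j - Y j * T)"
  define P where "P = (\<lambda>j. mat_adjoint (Y j) * M j * Y j + mat_adjoint (Z j) * E * Z j)"
  have [simp]: "E \<in> carrier_mat N N" using E by (simp add: psd_mats_def)
  note [simp] = Q S
  have [simp]: "T \<in> carrier_mat N N" by (simp add: T_def)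
  have [simp]: "Z j \<in> carrier_mat N N" "G j \<in> carrier_mat N N" "H j \<in> carrier_mat N N"
    if "j \<in> J" for j
    using R[OF that] Y[OF that] by (auto simp: Z_def G_def H_def intro!: minus_carrier_mat)
  have "P j \<in> psd_mats N" if j: "j \<in> J" for j
    unfolding P_def using ineq[OF j] Y[OF j] j E
    by (intro psd_mats_add psd_mats_congruence) (auto simp: M_def)
  then have "mat_sum N J P \<in> psd_mats N" by (rule psd_mats_mat_sum[OF J])
  also have "mat_sum N J P = mat_sum N J (\<lambda>j. mat_adjoint (G j) * Q + Q * G j + H j * S
      - mat_adjoint (G j) * (E * T) - (mat_adjoint T * E) * G j + mat_adjoint T * (H j * (E * T)))"
    unfolding P_def M_def Z_def G_def H_def
    by (intro mat_sum_cong completed_square[of _ N] R Y EY QY SY) simp_all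
  \<comment> \<open>The factors \<open>1\<close> are the sums of the \<open>H j\<close>.\<close>
  also have "\<dots> = mat_adjoint T * Q + Q * T + 1\<^sub>m N * S - mat_adjoint T * (E * T)
      - (mat_adjoint T * E) * T + mat_adjoint T * (1\<^sub>m N * (E * T))"
  proof -
    have sG: "mat_sum N J G = T" and sH: "mat_sum N J H = 1\<^sub>m N"
      using iso by (simp_all add: G_def H_def T_def)
    have sG': "mat_sum N J (\<lambda>j. mat_adjoint (G j)) = mat_adjoint T"
      by (simp add: mat_adjoint_mat_sum sG[symmetric])
    show ?thesis
      by (simp add: mat_sum_add mat_sum_minus mat_sum_mult_left mat_sum_mult_right J sG sH sG'
          mult_carrier_mat[of _ N N _ N] minus_carrier_mat[of _ N N] del: left_mult_one_mat assoc_mult_mat)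
  qed
  also have "\<dots> = mat_adjoint T * Q + Q * T + S - mat_adjoint T * E * T"
    by (simp add: assoc_mult_mat[of _ N N _ N _ N] left_mult_one_mat[of _ N N]
        mult_carrier_mat[of _ N N _ N]) (auto intro!: eq_matI)
  finally show ?thesis .
qed

section \<open>Weights that are scalar on each block\<close>

lemma block_diag_carrier [simp]:
  assumes "P \<in> carrier_mat n n" "Q \<in> carrier_mat m m"
  shows "block_diag P Q \<in> carrier_mat (n + m) (n + m)"
  using assms by (simp add: block_diag_def)

lemma mat_adjoint_block_diag:
  assumes "P \<in> carrier_mat n n" "Q \<in> carrier_mat m m"
  shows "mat_adjoint (block_diag P Q) = block_diag (mat_adjoint P) (mat_adjoint Q)"
proof -
  have "dim_row P = n" "dim_col P = n" "dim_row Q = m" "dim_col Q = m" using assms by auto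
  then show ?thesis by (intro eq_matI) (auto simp: block_diag_def)
qed

definition block_scalar :: "nat \<Rightarrow> nat \<Rightarrow> real \<Rightarrow> real \<Rightarrow> complex mat" where
  "block_scalar n m a b = block_diag (of_real a \<cdot>\<^sub>m 1\<^sub>m n) (of_real b \<cdot>\<^sub>m 1\<^sub>m m)"

lemma block_scalar_carrier [simp]: "block_scalar n m a b \<in> carrier_mat (n + m) (n + m)"
  by (simp add: block_scalar_def)

lemma block_scalar_eq_mat:
  "block_scalar n m a b = mat (n + m) (n + m)
     (\<lambda>(i, j). if i = j then of_real (if i < n then a else b) else 0)"
  by (intro eq_matI) (auto simp: block_scalar_def block_diag_def)

lemma block_scalar_commute:
  assumes "P \<in> carrier_mat n n" "Q \<in> carrier_mat m m"
  shows "block_scalar n m a b * block_diag P Q = block_diag P Q * block_scalar n m a b"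
proof -
  have dims: "dim_row P = n" "dim_col P = n" "dim_row Q = m" "dim_col Q = m" using assms by auto
  show ?thesis
    using assms unfolding block_scalar_def block_diag_def
    by (simp add: dims mult_four_block_mat[of _ n n _ m _ m _ _ n _ m]
        mult_smult_assoc_mat[of _ n n _ n] mult_smult_distrib[of _ n n _ n]
        mult_smult_assoc_mat[of _ m m _ m] mult_smult_distrib[of _ m m _ m])
qed

lemma block_scalar_psd:
  assumes "0 \<le> a" "0 \<le> b"
  shows "block_scalar n m a b \<in> psd_mats (n + m)"
proof -
  let ?D = "block_scalar n m a b"
  have "0 \<le> Re ((?D *\<^sub>v v) \<bullet>c v)" if v: "v \<in> carrier_vec (n + m)" for v
  proof -
    have "(?D *\<^sub>v v) $ i = of_real (if i < n then a else b) * v $ i" if "i < n + m" for i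
    proof -
      have "(?D *\<^sub>v v) $ i = (\<Sum>j<n + m. (if i = j then of_real (if i < n then a else b) else 0) * v $ j)"
        using that v by (auto simp: block_scalar_eq_mat scalar_prod_def atLeast0LessThan intro!: sum.cong)
      also have "\<dots> = (\<Sum>j<n + m. if i = j then of_real (if i < n then a else b) * v $ j else 0)"
        by (intro sum.cong) auto
      also have "\<dots> = of_real (if i < n then a else b) * v $ i"
        using that by (subst sum.delta') auto
      finally show ?thesis .
    qed
    then have "(?D *\<^sub>v v) \<bullet>c v =
        (\<Sum>i<n + m. of_real (if i < n then a else b) * v $ i * cnj (v $ i))"
      using v by (auto simp: scalar_prod_def atLeast0LessThan intro!: sum.cong)
    then have "Re ((?D *\<^sub>v v) \<bullet>c v) = (\<Sum>i<n + m. (if i < n then a else b) * (cmod (v $ i))\<^sup>2)"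
      by (simp add: Re_sum mult.assoc complex_mult_cnj cmod_power2)
    then show ?thesis using assms by (auto intro!: sum_nonneg)
  qed
  moreover have "mat_adjoint ?D = ?D"
    by (intro eq_matI) (auto simp: block_scalar_eq_mat)
  ultimately show ?thesis by (auto simp: psd_mats_def)
qed

text \<open>
  The weights \<open>(a, b)\<close> on the quadratic term are \<open>(0, 0)\<close>, \<open>(0, 1)\<close>, \<open>(1, 0)\<close> and \<open>(1, 1)\<close>:
  the first entry is 1 in the two discrete-time families and the second in the two bounded-real
  ones. Their nonnegativity makes the block scalar positive semidefinite.
\<close>

lemma W_hat_block_scalar:
  obtains a b c d p q where "0 \<le> a" "0 \<le> b"
    "W_hat n m l = four_block_mat (- block_scalar n m a b) (block_scalar n m c d)
       (block_scalar n m c d) (block_scalar n m p q)"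
proof -
  have neg: "- block_scalar n m a b = block_scalar n m (- a) (- b)" for a b
    by (intro eq_matI) (auto simp: block_scalar_eq_mat)
  have one: "(1 :: complex) \<cdot>\<^sub>m 1\<^sub>m r = 1\<^sub>m r" "(0 :: complex) \<cdot>\<^sub>m 1\<^sub>m r = 0\<^sub>m r r"
    "(- 1 :: complex) \<cdot>\<^sub>m 1\<^sub>m r = - 1\<^sub>m r" for r
    by (auto intro!: eq_matI)
  have zero: "block_diag (0\<^sub>m n n) (0\<^sub>m m m) = 0\<^sub>m (n + m) (n + m)"
    by (auto simp: block_diag_def)
  show thesis
  proof (cases l)
    case Label_alpha
    then show ?thesis using that[of 0 0 "- 1" 1 0 0] unfolding neg by (simp add: block_scalar_def one zero)
  next
    case Label_beta
    then show ?thesis using that[of 0 1 "- 1" 0 0 1] unfolding neg by (simp add: block_scalar_def one zero)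
  next
    case Label_gamma
    then show ?thesis using that[of 1 0 0 1 1 0] unfolding neg by (simp add: block_scalar_def one zero)
  next
    case Label_delta
    then show ?thesis using that[of 1 1 0 0 1 1] unfolding neg by (simp add: block_scalar_def one zero)
  qed
qed

section \<open>Matrix-convexity of the four families\<close>

lemma satisfies_W_average:
  assumes J: "finite J"
    and R: "\<And>j. j \<in> J \<Longrightarrow> R j \<in> carrier_mat (n + m) (n + m)"
    and W: "\<And>j. j \<in> J \<Longrightarrow> satisfies_W n m l (R j)"
    and Yn: "\<And>j. j \<in> J \<Longrightarrow> Yn j \<in> carrier_mat n n"
    and Ym: "\<And>j. j \<in> J \<Longrightarrow> Ym j \<in> carrier_mat m m"
    and Y: "\<And>j. j \<in> J \<Longrightarrow> Y j = block_diag (Yn j) (Ym j)"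
    and iso: "mat_sum (n + m) J (\<lambda>j. mat_adjoint (Y j) * Y j) = 1\<^sub>m (n + m)"
  shows "satisfies_W n m l (mat_sum (n + m) J (\<lambda>j. mat_adjoint (Y j) * R j * Y j))"
proof -
  obtain a b c d p q where ab: "0 \<le> a" "0 \<le> b"
    and W_eq: "W_hat n m l = four_block_mat (- block_scalar n m a b) (block_scalar n m c d)
       (block_scalar n m c d) (block_scalar n m p q)"
    by (rule W_hat_block_scalar)
  have comm: "block_scalar n m s t * Y j = Y j * block_scalar n m s t"
    "block_scalar n m s t * mat_adjoint (Y j) = mat_adjoint (Y j) * block_scalar n m s t"
    if "j \<in> J" for j s t
    using Yn[OF that] Ym[OF that] by (auto simp: Y[OF that] mat_adjoint_block_diag block_scalar_commute)
  have "mat_adjoint (R j) * block_scalar n m c d + block_scalar n m c d * R j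
      + block_scalar n m p q - mat_adjoint (R j) * block_scalar n m a b * R j \<in> psd_mats (n + m)"
    if "j \<in> J" for j
    using W[OF that] R[OF that] by (simp add: satisfies_W_def W_eq stacked_congruence)
  then have "mat_adjoint T * block_scalar n m c d + block_scalar n m c d * T
      + block_scalar n m p q - mat_adjoint T * block_scalar n m a b * T \<in> psd_mats (n + m)"
    if "T = mat_sum (n + m) J (\<lambda>j. mat_adjoint (Y j) * R j * Y j)" for T
    unfolding that using J R Yn Ym iso comm ab
    by (intro quadratic_inequality_isometric_average block_scalar_psd) (auto simp: Y)
  then show ?thesis by (simp add: satisfies_W_def W_eq stacked_congruence)
qed

theorem proposition6p3:
  fixes n m :: nat and l :: label
  shows
    "(\<forall>(k::nat) (F :: nat \<Rightarrow> rat_fun_mat) (R :: nat \<Rightarrow> complex mat)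
       (Yn :: nat \<Rightarrow> complex mat) (Ym :: nat \<Rightarrow> complex mat) (Y :: nat \<Rightarrow> complex mat) (RF :: complex mat).
        (\<forall>j\<in>{1..k}. F j \<in> carrier_mat m m \<and> is_realization n m (F j) (R j) \<and> satisfies_W n m l (R j)) \<longrightarrow>
        (\<forall>j\<in>{1..k}. Yn j \<in> carrier_mat n n \<and> Ym j \<in> carrier_mat m m \<and>
                     Y j = block_diag (Yn j) (Ym j)) \<longrightarrow>
        mat_sum (n + m) {1..k} (\<lambda>j. mat_adjoint (Y j) * Y j) = 1\<^sub>m (n + m) \<longrightarrow>
        RF = mat_sum (n + m) {1..k} (\<lambda>j. mat_adjoint (Y j) * R j * Y j) \<longrightarrow>
        satisfies_W n m l RF)
     \<and> matrix_convex n m {R \<in> carrier_mat (n + m) (n + m). satisfies_W n m l R}"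
proof (intro conjI allI impI)
  fix k :: nat and F R Yn Ym Y RF
  assume R: "\<forall>j\<in>{1..k}. F j \<in> carrier_mat m m \<and> is_realization n m (F j) (R j) \<and> satisfies_W n m l (R j)"
    and Y: "\<forall>j\<in>{1..k}. Yn j \<in> carrier_mat n n \<and> Ym j \<in> carrier_mat m m \<and> Y j = block_diag (Yn j) (Ym j)"
    and iso: "mat_sum (n + m) {1..k} (\<lambda>j. mat_adjoint (Y j) * Y j) = 1\<^sub>m (n + m)"
    and RF: "RF = mat_sum (n + m) {1..k} (\<lambda>j. mat_adjoint (Y j) * R j * Y j)"
  have "R j \<in> carrier_mat (n + m) (n + m)" if "j \<in> {1..k}" for j
  proof -
    have "is_realization n m (F j) (R j)" using R that by blast
    then show ?thesis by (auto simp: is_realization_def)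
  qed
  then show "satisfies_W n m l RF"
    unfolding RF using R Y iso by (intro satisfies_W_average[where Yn = Yn and Ym = Ym]) auto
next
  show "matrix_convex n m {R \<in> carrier_mat (n + m) (n + m). satisfies_W n m l R}"
    unfolding matrix_convex_def
  proof (intro conjI allI impI CollectI mat_sum_carrier)
    fix k :: nat and R Yn Ym
    assume "\<forall>j\<in>{1..k}. R j \<in> {R \<in> carrier_mat (n + m) (n + m). satisfies_W n m l R} \<and>
        Yn j \<in> carrier_mat n n \<and> Ym j \<in> carrier_mat m m"
      and "mat_sum (n + m) {1..k} (\<lambda>j. mat_adjoint (block_diag (Yn j) (Ym j))
        * block_diag (Yn j) (Ym j)) = 1\<^sub>m (n + m)"
    then show "satisfies_W n m l (mat_sum (n + m) {1..k} (\<lambda>j.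
        mat_adjoint (block_diag (Yn j) (Ym j)) * R j * block_diag (Yn j) (Ym j)))"
      by (intro satisfies_W_average[where Yn = Yn and Ym = Ym]) auto
  qed auto
qed

end
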